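(* Let $e\geq 2$ be an integer, let $p$ be a positive integer dividing $e$ and set $e' := \frac{e}{p}$. For every partition $\lambda$ we have $$\alpha(\sigma\lambda)=\sigma\cdot\alpha(\lambda) \iff |\sigma\lambda| = |\lambda| \iff c_0(\lambda)=c_{e'}(\lambda),$$ where the index $e'$ is read modulo $e$.
   Context: A partition is a finite non-increasing sequence $\lambda=(\lambda_1\ge\dots\ge\lambda_h>0)$ of positive integers (possibly empty), of size $|\lambda|=\sum_a\lambda_a$, with nodes the pairs $(a,b)$, $1\le a\le h$, $1\le b\le\lambda_a$. The residue of $(a,b)$ is $b-a \bmod e$, and $c_i(\lambda)$ is the number of nodes of residue $i\in\mathbb{Z}/e\mathbb{Z}$. $Q=\bigoplus_{i\in\mathbb{Z}/e\mathbb{Z}}\mathbb{Z}\alpha_i$ is free abelian with basis $(\alpha_i)$, and $\alpha(\lambda):=\sum_i c_i(\lambda)\alpha_i\in Q$. The map $\sigma:Q\to Q$, $\alpha\mapsto\sigma\cdot\alpha$, is the $\mathbb{Z}$-linear map with $\sigma\cdot\alpha_i:=\alpha_{i-e'}$ for all $i\in\mathbb{Z}/e\mathbb{Z}$. Shift of partitions. The beta-set of $\lambda$ is $\beta(\lambda)=\{\lambda_a-a: a\ge1\}\subseteq\mathbb{Z}$, with $\lambda_a:=0$ for $a>h$. Its $e$-abacus has runners $R_i(\lambda):=\{j\in\mathbb{Z}: i+je\in\beta(\lambda)\}$ for $i\in\{0,\dots,e-1\}$. The partition $\sigma\lambda$ is the unique partition with $R_i(\sigma\lambda)=R_{(i+e')\bmod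 e}(\lambda)$ for all $i\in\{0,\dots,e-1\}$. (Equivalently, both the $e$-quotient and the $e$-core abacus positions are cyclically shifted by $e'$.) *)

theory Defs
  imports "HOL-Library.Poly_Mapping"
begin

definition is_partition :: "nat list \<Rightarrow> bool" where
  "is_partition l \<longleftrightarrow> sorted_wrt (\<ge>) l \<and> (\<forall>x\<in>set l. 0 < x)"

text \<open>Parts are numbered from 1, and a part beyond the length is 0.\<close>

definition part :: "nat list \<Rightarrow> nat \<Rightarrow> nat" where
  "part l a = (if 1 \<le> a \<and> a \<le> length l then l ! (a - 1) else 0)"

definition nodes :: "nat list \<Rightarrow> (nat \<times> nat) set" where
  "nodes l = {(a, b). 1 \<le> a \<and> a \<le> length l \<and> 1 \<le> b \<and> b \<le> part l a}"

text \<open>The elements of \<open>\<int>/e\<int>\<close> are represented by the integers in \<open>{0..<e}\<close>.\<close>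

definition residue :: "nat \<Rightarrow> nat \<times> nat \<Rightarrow> int" where
  "residue e n = (int (snd n) - int (fst n)) mod int e"

definition residue_count :: "nat \<Rightarrow> int \<Rightarrow> nat list \<Rightarrow> nat" where
  "residue_count e i l = card {n \<in> nodes l. residue e n = i}"

text \<open>
  The lattice \<open>Q\<close> consists of the finitely supported maps \<open>int \<Rightarrow>\<^sub>0 int\<close> whose
  keys lie in \<open>{0..<e}\<close>; its basis vector \<open>\<alpha>\<^sub>i\<close> is \<open>frag_of i\<close>.
\<close>

definition alpha :: "nat \<Rightarrow> nat list \<Rightarrow> int \<Rightarrow>\<^sub>0 int" where
  "alpha e l = (\<Sum>i\<in>{0..<int e}. frag_cmul (int (residue_count e i l)) (frag_of i))"

text \<open>The \<open>\<int>\<close>-linear extension of \<open>\<alpha>\<^sub>i \<mapsto> \<alpha>\<^bsub>i - e'\<^esub>\<close>.\<close>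

definition shift_Q :: "nat \<Rightarrow> nat \<Rightarrow> (int \<Rightarrow>\<^sub>0 int) \<Rightarrow> (int \<Rightarrow>\<^sub>0 int)" where
  "shift_Q e e' = frag_extend (\<lambda>i. frag_of ((i - int e') mod int e))"

definition beta_set :: "nat list \<Rightarrow> int set" where
  "beta_set l = {int (part l a) - int a | a. 1 \<le> a}"

definition runner :: "nat \<Rightarrow> int \<Rightarrow> nat list \<Rightarrow> int set" where
  "runner e i l = {j. i + j * int e \<in> beta_set l}"

definition shift_partition :: "nat \<Rightarrow> nat \<Rightarrow> nat list \<Rightarrow> nat list" where
  "shift_partition e e' l =
     (THE m. is_partition m \<and>
        (\<forall>i\<in>{0..<int e}. runner e i m = runner e ((i + int e') mod int e) l))"

end

theory Submission
  imports Defs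
begin

text \<open>
  Write \<open>t = e' mod e\<close>, and let \<open>c\<^sub>i(l)\<close> be the number of nodes of residue \<open>i\<close>. The whole
  theorem follows from one identity: for every residue \<open>i\<close>,
    \<open>c\<^sub>i(\<sigma> l) - c\<^bsub>i+t\<^esub>(l) = c\<^sub>0(l) - c\<^sub>t(l)\<close>,
  where the right-hand side \<open>d\<close> does not depend on \<open>i\<close>. Since the coefficient of \<open>\<alpha>\<^sub>i\<close> in
  \<open>\<sigma> \<cdot> \<alpha>(l)\<close> is \<open>c\<^bsub>i+t\<^esub>(l)\<close>, the first condition of the theorem says that \<open>d = 0\<close>.
  Summing over the \<open>e\<close> residues gives \<open>\<bar>\<sigma> l\<bar> - \<bar>l\<bar> = e * d\<close>, so the second one says the same,
  and so does the third by the definition of \<open>d\<close>.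

  For the identity, read the nodes of row \<open>a\<close> as the unit steps by which the bead of that row
  moves from its place \<open>-a\<close> in the empty partition up to \<open>l\<^sub>a - a\<close>. The contents of these nodes are
  the positions reached by the steps, so the row contributes
  \<open>(l\<^sub>a - a - i) div e - (-a - i) div e\<close> to \<open>c\<^sub>i(l)\<close> (\<open>residue_count_eq_sum\<close>). In this sum only
  the set of beads matters, and the beta-sets of \<open>\<sigma> l\<close> and \<open>l\<close> correspond under the permutation
  of \<open>\<int>\<close> that rotates the runners and keeps the level \<open>x div e\<close>
  (\<open>sum_over_rotated_beads\<close>; the empty partition is sent to itself). It remains to compare
  \<open>(x - i) div e\<close> with the same kind of term at the image \<open>y\<close> of \<open>x\<close>. Up to a constant, which
  cancels between the beads of the partition and those of the empty one, it equals
  \<open>(y - (i + t) mod e) div e + y div e - (y - t) div e\<close> (\<open>rotate_runners_crossings\<close>),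
  and the three terms are those of \<open>c\<^bsub>i+t\<^esub>(l)\<close>, \<open>c\<^sub>0(l)\<close> and \<open>c\<^sub>t(l)\<close>.

  The partition \<open>\<sigma> l\<close> is given by a definite description, so it must also be shown that a
  partition is determined by its beta-set (\<open>beta_set_inject\<close>) and that a set of integers is a
  beta-set as soon as, for some \<open>n\<close>, it has exactly \<open>n\<close> elements \<open>\<ge> -n\<close> and contains
  everything below \<open>-n\<close> (\<open>beta_set_exists\<close>). Rotating the runners preserves this property when \<open>e\<close> divides \<open>n\<close>.
\<close>

section \<open>Partitions and their beta-sets\<close>

lemma part_Nil [simp]: "part [] a = 0"
  by (simp add: part_def)

lemma part_Cons [simp]: "part (x # l) (Suc 0) = x"
  "1 \<le> a \<Longrightarrow> part (x # l) (Suc a) = part l a"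
  by (auto simp: part_def nth_Cons split: nat.splits)

lemma part_beyond: "length l < a \<Longrightarrow> part l a = 0"
  by (simp add: part_def)

lemma part_antimono:
  assumes "is_partition l" "1 \<le> a" "a \<le> b"
  shows "part l b \<le> part l a"
  using assms unfolding is_partition_def part_def sorted_wrt_iff_nth_less
  by (cases "a = b") auto

definition bead :: "nat list \<Rightarrow> nat \<Rightarrow> int" where
  "bead l a = int (part l a) - int a"

lemma bead_strict_decreasing:
  assumes "is_partition l" "1 \<le> a" "a < b"
  shows "bead l b < bead l a"
  using part_antimono[OF assms(1,2), of b] assms(3) by (simp add: bead_def)

lemma inj_on_bead: "is_partition l \<Longrightarrow> inj_on (bead l) {1..n}"
  by (rule linorder_inj_onI) (use bead_strict_decreasing in fastforce)+

lemma beta_set_bead: "beta_set l = bead l ` {1..}"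
  by (auto simp: beta_set_def bead_def)

lemma beta_set_truncate:
  assumes "length l \<le> n"
  shows "{x \<in> beta_set l. - int n \<le> x} = bead l ` {1..n}"
proof -
  have "1 \<le> a \<Longrightarrow> - int n \<le> bead l a \<longleftrightarrow> a \<le> n" for a
    using assms part_beyond[of l a] by (cases "a \<le> n") (auto simp: bead_def)
  then show ?thesis by (auto simp: beta_set_bead)
qed

lemma below_in_beta_set:
  assumes "length l \<le> n" "x < - int n"
  shows "x \<in> beta_set l"
proof -
  have "x = bead l (nat (- x))"
    using assms by (simp add: bead_def part_beyond)
  then show ?thesis using assms by (auto simp: beta_set_bead)
qed

lemma beta_set_Nil: "beta_set [] = {..< 0}"
proof -
  have "x \<in> beta_set []" if "x < 0" for x
    using below_in_beta_set[of "[]" 0 x] that by simp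
  then show ?thesis by (auto simp: beta_set_def)
qed

text \<open>
  The recursion that drives both inductions below: removing the largest bead and moving all the
  others up by one removes the first row.
\<close>
lemma beta_set_Cons: "beta_set (k # l) = insert (int k - 1) ((\<lambda>x. x - 1) ` beta_set l)"
proof -
  have "{1..} = insert 1 (Suc ` {1..})"
  proof (rule set_eqI)
    fix a :: nat
    show "a \<in> {1..} \<longleftrightarrow> a \<in> insert 1 (Suc ` {1..})"
      by (cases a) auto
  qed
  moreover have "bead (k # l) ` Suc ` {1..} = (\<lambda>x. x - 1) ` bead l ` {1..}"
    unfolding image_image by (rule image_cong) (auto simp: bead_def)
  moreover have "bead (k # l) 1 = int k - 1" by (simp add: bead_def)
  ultimately show ?thesis unfolding beta_set_bead by (metis image_insert)
qed

lemma beta_set_less: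
  assumes "is_partition l" "\<forall>y\<in>set l. y \<le> k" "x \<in> beta_set l"
  shows "x < int k"
proof -
  obtain a where "1 \<le> a" "x = int (part l a) - int a"
    using assms(3) by (auto simp: beta_set_def)
  moreover have "part l a \<le> k" using assms(2) by (auto simp: part_def)
  ultimately show ?thesis by linarith
qed

lemma is_partition_Cons:
  "is_partition (k # l) \<longleftrightarrow> 0 < k \<and> (\<forall>y\<in>set l. y \<le> k) \<and> is_partition l"
  by (auto simp: is_partition_def)

lemma beta_set_Cons_less:
  "is_partition (k # l) \<Longrightarrow> x \<in> beta_set (k # l) \<Longrightarrow> x < int k"
  by (rule beta_set_less) (auto simp: is_partition_Cons)

lemma in_beta_set_tail_iff:
  assumes "is_partition (k # l)"
  shows "x \<in> beta_set l \<longleftrightarrow> x - 1 \<in> beta_set (k # l) \<and> x \<noteq> int k"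
proof -
  have "int k \<notin> beta_set l"
    using assms beta_set_less[of l k "int k"] by (auto simp: is_partition_Cons)
  then show ?thesis by (auto simp: beta_set_Cons)
qed

lemma beta_set_Cons_neq_Nil:
  assumes "is_partition (k # l)"
  shows "beta_set (k # l) \<noteq> beta_set []"
proof -
  have "int k - 1 \<in> beta_set (k # l)" by (simp add: beta_set_Cons)
  moreover have "int k - 1 \<notin> beta_set []"
    using assms by (simp add: beta_set_Nil is_partition_Cons)
  ultimately show ?thesis by blast
qed

lemma beta_set_inject:
  assumes "is_partition l" "is_partition m" "beta_set l = beta_set m"
  shows "l = m"
  using assms
proof (induction l arbitrary: m)
  case Nil
  then show ?case using beta_set_Cons_neq_Nil by (cases m) metis+
next
  case (Cons k l)
  show ?case
  proof (cases m)
    case Nil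
    then show ?thesis using Cons.prems beta_set_Cons_neq_Nil by metis
  next
    case m: (Cons k' l')
    have "int k - 1 \<in> beta_set (k' # l')" "int k' - 1 \<in> beta_set (k # l)"
      using Cons.prems(3) unfolding m by (metis beta_set_Cons insertI1)+
    then have k: "k = k'"
      using beta_set_Cons_less[of k' l' "int k - 1"] beta_set_Cons_less[of k l "int k' - 1"]
        Cons.prems(1,2) unfolding m by linarith
    have "beta_set l = beta_set l'"
      using in_beta_set_tail_iff Cons.prems unfolding m k by blast
    then show ?thesis
      using Cons.IH[of l'] Cons.prems m k by (simp add: is_partition_Cons)
  qed
qed

text \<open>
  By induction on \<open>n\<close>: the largest element of \<open>B\<close> is the first bead, and the rest, moved up by one,
  satisfies the hypothesis for \<open>n - 1\<close>. The count forces the first bead to be at least \<open>-1\<close>. If it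
  is \<open>-1\<close> then all beads are in the position of the empty partition, and no row with a positive
  part may be added.
\<close>
lemma beta_set_exists:
  fixes B :: "int set"
  assumes "card {x \<in> B. - int n \<le> x} = n" "finite {x \<in> B. - int n \<le> x}"
    and "{..< - int n} \<subseteq> B"
  shows "\<exists>l. is_partition l \<and> beta_set l = B"
  using assms
proof (induction n arbitrary: B)
  case 0
  then have "B = {..<0}" by force
  then show ?case
    by (intro exI[of _ "[]"]) (simp add: beta_set_Nil is_partition_def)
next
  case (Suc n)
  define A where "A = {x \<in> B. - int (Suc n) \<le> x}"
  have A: "finite A" "card A = Suc n" using Suc.prems by (simp_all add: A_def)
  then have "A \<noteq> {}" by auto
  define M where "M = Max A"
  have M: "M \<in> A" "\<And>x. x \<in> A \<Longrightarrow> x \<le> M"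
    using A \<open>A \<noteq> {}\<close> by (auto simp: M_def)
  then have le_M: "x \<le> M" if "x \<in> B" for x
    using that by (cases "x \<in> A") (force simp: A_def)+
  have A_sub: "A \<subseteq> {- int (Suc n)..M}" using M by (auto simp: A_def)
  then have "Suc n \<le> card {- int (Suc n)..M}"
    using card_mono[OF _ A_sub] A by simp
  then have M_ge: "- 1 \<le> M" by simp
  show ?case
  proof (cases "M = -1")
    case True
    then have "A = {- int (Suc n)..M}"
      using A_sub A by (intro card_subset_eq) auto
    then have "B = {..<0}"
      using Suc.prems(3) le_M True by (force simp: A_def)
    then show ?thesis
      by (intro exI[of _ "[]"]) (simp add: beta_set_Nil is_partition_def)
  next
    case False
    define C where "C = (\<lambda>x. x + 1) ` (B - {M})"
    have C: "{x \<in> C. - int n \<le> x} = (\<lambda>x. x + 1) ` (A - {M})"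
      by (auto simp: C_def A_def)
    have "card {x \<in> C. - int n \<le> x} = n"
      unfolding C using A M by (subst card_image) (auto simp: inj_on_def)
    moreover have "finite {x \<in> C. - int n \<le> x}" unfolding C using A by simp
    moreover have "{..< - int n} \<subseteq> C"
    proof
      fix x assume "x \<in> {..< - int n}"
      then have "x - 1 \<in> B - {M}" using Suc.prems(3) M_ge by auto
      then show "x \<in> C" unfolding C_def by force
    qed
    ultimately obtain l where l: "is_partition l" "beta_set l = C"
      using Suc.IH by blast
    define k where "k = nat (M + 1)"
    have k: "int k = M + 1" "0 < k" using M_ge False by (auto simp: k_def)
    have "y \<le> k" if "y \<in> set l" for y
    proof -
      have "hd l \<le> k"
      proof -
        have "int (hd l) - 1 \<in> C"
          using that l by (cases l) (auto simp: beta_set_Cons)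
        then have "int (hd l) - 1 \<le> M" unfolding C_def using le_M by force
        then show ?thesis using k by simp
      qed
      moreover have "y \<le> hd l" using that l by (cases l) (auto simp: is_partition_Cons)
      ultimately show ?thesis by simp
    qed
    then have "is_partition (k # l)" using l k by (simp add: is_partition_Cons)
    moreover have "beta_set (k # l) = B"
      using M unfolding beta_set_Cons l C_def by (force simp: k A_def image_image)
    ultimately show ?thesis by blast
  qed
qed

section \<open>Rotating the runners of the abacus\<close>

text \<open>
  Unlike the translation by \<open>t\<close>, this permutation keeps the level \<open>x div e\<close> when the runner
  wraps around from \<open>e - 1\<close> to \<open>0\<close>, as the definition of \<open>\<sigma>\<close> by runners requires.
\<close>
definition rotate_runners :: "nat \<Rightarrow> int \<Rightarrow> int \<Rightarrow> int" where
  "rotate_runners e t x = (x + t) mod int e + x div int e * int e"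

lemma rotate_runners_div [simp]: "0 < e \<Longrightarrow> rotate_runners e t x div int e = x div int e"
  by (simp add: rotate_runners_def)

lemma rotate_runners_mod [simp]: "rotate_runners e t x mod int e = (x + t) mod int e"
  by (simp add: rotate_runners_def)

lemma rotate_runners_inverse:
  assumes "0 < e" "t + u = 0"
  shows "rotate_runners e u (rotate_runners e t x) = x"
proof -
  have "(rotate_runners e t x + u) mod int e = (x + (t + u)) mod int e"
    by (metis rotate_runners_mod mod_add_left_eq add.assoc)
  then show ?thesis
    using assms by (simp add: rotate_runners_def[of e u] add.commute)
qed

text \<open>
  A bound that is a multiple of \<open>e\<close> depends on the level only, so that it is compatible with the
  rotation. This is why beta-sets are cut off at such a bound before they are transported.
\<close>
lemma rotate_runners_ge_iff:
  assumes "0 < e"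
  shows "- int (M * e) \<le> rotate_runners e t x \<longleftrightarrow> - int (M * e) \<le> x"
proof -
  have "- int (M * e) \<le> y \<longleftrightarrow> - int M \<le> y div int e" for y
  proof -
    have "(y + int M * int e) div int e = y div int e + int M"
      using assms by simp
    moreover have "0 \<le> (y + int M * int e) div int e \<longleftrightarrow> 0 \<le> y + int M * int e"
      using assms by (intro pos_imp_zdiv_nonneg_iff) simp
    ultimately show ?thesis unfolding of_nat_mult by linarith
  qed
  then show ?thesis using assms by simp
qed

lemma runner_eq_iff:
  assumes "0 < e"
  shows "(\<forall>i\<in>{0..<int e}. runner e i m = runner e ((i + t) mod int e) l) \<longleftrightarrow>
    (\<forall>x. x \<in> beta_set m \<longleftrightarrow> rotate_runners e t x \<in> beta_set l)"
proof -
  have rot: "rotate_runners e t (i + j * int e) = (i + t) mod int e + j * int e"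
    if "i \<in> {0..<int e}" for i j
  proof -
    have "i + j * int e + t = (i + t) + j * int e" by simp
    then have "(i + j * int e + t) mod int e = (i + t) mod int e"
      by (simp only: mod_mult_self1)
    then show ?thesis using that by (simp add: rotate_runners_def)
  qed
  show ?thesis
  proof
    assume *: "\<forall>i\<in>{0..<int e}. runner e i m = runner e ((i + t) mod int e) l"
    show "\<forall>x. x \<in> beta_set m \<longleftrightarrow> rotate_runners e t x \<in> beta_set l"
    proof
      fix x
      have "x mod int e \<in> {0..<int e}" using assms by simp
      then have "x div int e \<in> runner e (x mod int e) m \<longleftrightarrow>
          x div int e \<in> runner e ((x mod int e + t) mod int e) l" using * by blast
      then show "x \<in> beta_set m \<longleftrightarrow> rotate_runners e t x \<in> beta_set l"
        by (simp add: runner_def rotate_runners_def mod_simps)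
    qed
  qed (simp add: runner_def rot)
qed

lemma sum_over_rotated_beads:
  fixes F :: "int \<Rightarrow> int"
  assumes "0 < e" "is_partition l" "is_partition m"
    and "\<And>x. x \<in> beta_set m \<longleftrightarrow> rotate_runners e t x \<in> beta_set l"
    and "length l \<le> M * e" "length m \<le> M * e"
  shows "(\<Sum>a=1..M*e. F (rotate_runners e t (bead m a))) = (\<Sum>a=1..M*e. F (bead l a))"
proof -
  define above where "above k = {x \<in> beta_set k. - int (M * e) \<le> x}" for k
  have beads: "sum G (above k) = (\<Sum>a=1..M*e. G (bead k a))"
    if "is_partition k" "length k \<le> M * e" for G :: "int \<Rightarrow> int" and k
    using that unfolding above_def
    by (simp only: beta_set_truncate sum.reindex[OF inj_on_bead] o_def)
  have "(\<Sum>x\<in>above m. F (rotate_runners e t x)) = (\<Sum>x\<in>above l. F x)"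
    using assms(1,4) unfolding above_def
    by (intro sum.reindex_bij_witness[of _ "rotate_runners e (- t)" "rotate_runners e t"])
      (auto simp: rotate_runners_inverse rotate_runners_ge_iff simp del: of_nat_mult)
  then show ?thesis using beads assms by simp
qed

section \<open>The effect of a rotation on residue crossings\<close>

lemma div_diff_residue:
  fixes e r i j :: int
  assumes "0 \<le> r" "r < e" "0 \<le> i" "i < e"
  shows "(r + j * e - i) div e = j - (if r < i then 1 else 0)"
proof -
  have "(r + j * e - i) div e = j + (r - i) div e"
  proof -
    have "r + j * e - i = (r - i) + j * e" by simp
    then show ?thesis using assms by (simp only: div_mult_self1)
  qed
  moreover have "(r - i) div e = (if r < i then - 1 else 0)"
    using assms int_div_pos_eq[of "r - i" e "- 1" "r - i + e"] by auto
  ultimately show ?thesis by simp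
qed

text \<open>
  Let \<open>r\<close> be the residue of \<open>x\<close> and \<open>j\<close> its level, so that \<open>(x - i) div e = j - [r < i]\<close>, and
  similarly for \<open>y\<close>, whose residue is \<open>(r + t) mod e\<close>. The claim then compares four brackets. It
  holds because rotation preserves the order of residues except across the wrap-around, which
  happens for \<open>y\<close> exactly when its residue is less than \<open>t\<close>, that is, when
  \<open>y div e - (y - t) div e = 1\<close>. The last term, 0 or 1, records whether \<open>i\<close> itself wraps around.
\<close>
lemma rotate_runners_crossings:
  fixes i t x :: int
  assumes "i \<in> {0..<int e}" "t \<in> {0..<int e}"
  defines "y \<equiv> rotate_runners e t x"
  shows "(x - i) div int e =
    (y - (i + t) mod int e) div int e + (y - 0) div int e - (y - t) div int e - (i + t) div int e"
proof -
  define E where "E = int e"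
  define r j where "r = x mod E" and "j = x div E"
  have E: "0 < E" using assms by (auto simp: E_def)
  have r: "0 \<le> r" "r < E" using E by (auto simp: r_def)
  have x: "x = r + j * E" by (simp add: r_def j_def)
  have it: "0 \<le> i" "i < E" "0 \<le> t" "t < E" using assms by (auto simp: E_def)
  have wrap: "(a + b) mod E = (if a + b < E then a + b else a + b - E) \<and>
      (a + b) div E = (if a + b < E then 0 else 1)"
    if "0 \<le> a" "a < E" "0 \<le> b" "b < E" for a b
  proof (cases "a + b < E")
    case False
    then show ?thesis
      using that int_div_pos_eq[of "a + b" E 1 "a + b - E"]
        int_mod_pos_eq[of "a + b" E 1 "a + b - E"] by auto
  qed (use that in auto)
  define s where "s = (r + t) mod E"
  have s: "0 \<le> s" "s < E" using E by (auto simp: s_def)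
  have y: "y = s + j * E"
    by (simp add: y_def rotate_runners_def s_def r_def j_def E_def mod_simps)
  have k: "0 \<le> (i + t) mod E" "(i + t) mod E < E" using E by auto
  show ?thesis
    unfolding x y E_def[symmetric] div_diff_residue[OF r it(1,2)] div_diff_residue[OF s k]
      div_diff_residue[OF s order_refl E] div_diff_residue[OF s it(3,4)]
    unfolding s_def wrap[OF it, THEN conjunct1] wrap[OF it, THEN conjunct2]
      wrap[OF r it(3,4), THEN conjunct1]
    using r it by auto
qed

section \<open>Counting nodes of a given residue by beads\<close>

lemma card_row_residue:
  assumes "i \<in> {0..<int e}"
  shows "int (card {b \<in> {1..q}. (int b - int a) mod int e = i}) =
    (int q - int a - i) div int e - (- int a - i) div int e"
proof (induction q)
  case 0
  then show ?case by simp
next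
  case (Suc q)
  define x where "x = int q - int a"
  have "{b \<in> {1..Suc q}. (int b - int a) mod int e = i} =
     {b \<in> {1..q}. (int b - int a) mod int e = i} \<union> (if (x + 1) mod int e = i then {Suc q} else {})"
    by (auto simp: x_def le_Suc_eq algebra_simps)
  then have "int (card {b \<in> {1..Suc q}. (int b - int a) mod int e = i}) =
     int (card {b \<in> {1..q}. (int b - int a) mod int e = i}) + (if (x + 1) mod int e = i then 1 else 0)"
    by simp
  moreover have "(x + 1 - i) div int e - (x - i) div int e = (if (x + 1) mod int e = i then 1 else 0)"
  proof -
    define r j where "r = (x + 1) mod int e" and "j = (x + 1) div int e"
    have r: "0 \<le> r" "r < int e" using assms by (auto simp: r_def)
    have "x + 1 = r + j * int e" by (simp add: r_def j_def)
    then have x: "x = r - 1 + j * int e" by simp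
    have "(r + j * int e - i) div int e = j - (if r < i then 1 else 0)"
      using div_diff_residue[OF r] assms by simp
    moreover have "(r - 1 + j * int e - i) div int e = j - (if r \<le> i then 1 else 0)"
    \<comment> \<open>compare with the residue \<open>i + 1\<close>, which is \<open>0\<close> on the next level when \<open>i = e - 1\<close>\<close>
    proof (cases "i + 1 < int e")
      case True
      moreover have "r - 1 + j * int e - i = r + j * int e - (i + 1)" by simp
      ultimately show ?thesis
        using div_diff_residue[OF r, of "i + 1" j] assms by (simp only:) auto
    next
      case False
      then have "i = int e - 1" using assms by simp
      then have "r - 1 + j * int e - i = r + (j - 1) * int e - 0" by (simp add: algebra_simps)
      then show ?thesis
        using div_diff_residue[OF r, of 0 "j - 1"] assms r \<open>i = int e - 1\<close> by simp
    qed
    ultimately show ?thesis unfolding x r_def[symmetric] by (auto simp: x r)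
  qed
  moreover have "int (Suc q) - int a = x + 1" "int q - int a = x" by (simp_all add: x_def)
  ultimately show ?case using Suc.IH by (simp only:)
qed

lemma nodes_eq_Sigma: "length l \<le> n \<Longrightarrow> nodes l = (SIGMA a:{1..n}. {1..part l a})"
  by (auto simp: nodes_def part_def split: if_splits)

text \<open>
  As \<open>bead [] a = -a\<close>, each term counts the positions congruent to \<open>i\<close> that the bead of row \<open>a\<close>
  reaches when it moves from the empty partition to \<open>l\<close>. The number \<open>n\<close> of rows may exceed the
  length, which allows two partitions to be compared over the same range.
\<close>
lemma residue_count_eq_sum:
  assumes "i \<in> {0..<int e}" "length l \<le> n"
  shows "int (residue_count e i l) =
    (\<Sum>a=1..n. (bead l a - i) div int e - (bead [] a - i) div int e)"
proof -
  have "{x \<in> nodes l. residue e x = i} =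
     (SIGMA a:{1..n}. {b \<in> {1..part l a}. (int b - int a) mod int e = i})"
    unfolding nodes_eq_Sigma[OF assms(2)] by (auto simp: residue_def)
  then have "residue_count e i l =
     (\<Sum>a=1..n. card {b \<in> {1..part l a}. (int b - int a) mod int e = i})"
    unfolding residue_count_def by simp
  then show ?thesis
    by (simp only: of_nat_sum card_row_residue[OF assms(1)]) (simp add: bead_def)
qed

lemma sum_list_eq_sum_residue_count:
  assumes "0 < e"
  shows "int (sum_list l) = (\<Sum>i\<in>{0..<int e}. int (residue_count e i l))"
proof -
  have fin: "finite (nodes l)" unfolding nodes_eq_Sigma[OF order_refl] by simp
  have "sum_list l = (\<Sum>a=1..length l. part l a)"
    unfolding sum_list_sum_nth
    by (rule sum.reindex_bij_witness[of _ "\<lambda>a. a - 1" Suc]) (auto simp: part_def)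
  also have "\<dots> = card (nodes l)"
    unfolding nodes_eq_Sigma[OF order_refl] by simp
  also have "\<dots> = (\<Sum>i\<in>{0..<int e}. residue_count e i l)"
    unfolding residue_count_def card_eq_sum
    by (rule sum.group[symmetric]) (use fin assms in \<open>auto simp: residue_def\<close>)
  finally show ?thesis by simp
qed

text \<open>
  The key identity. The beads of the empty partition enter the count of every partition; since
  the rotation maps that beta-set, the negative integers, to itself, they are transported by the
  same lemma as the beads of \<open>m\<close>.
\<close>
lemma residue_count_rotated:
  assumes "0 < e" "is_partition l" "is_partition m"
    and rot: "\<And>x. x \<in> beta_set m \<longleftrightarrow> rotate_runners e t x \<in> beta_set l"
    and i: "i \<in> {0..<int e}" and t: "t \<in> {0..<int e}"
  shows "int (residue_count e i m) = int (residue_count e ((i + t) mod int e) l)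
     + int (residue_count e 0 l) - int (residue_count e t l)"
proof -
  define M where "M = length l + length m"
  have len: "length l \<le> M * e" "length m \<le> M * e" "length [] \<le> M * e"
    using assms(1) by (auto simp: M_def intro: order_trans[OF _ mult_le_mono2[of 1]])
  define k where "k = (i + t) mod int e"
  have k: "k \<in> {0..<int e}" using assms(1) by (simp add: k_def)
  define F where "F x = (x - k) div int e + (x - 0) div int e - (x - t) div int e - (i + t) div int e" for x
  have nil: "is_partition []" by (simp add: is_partition_def)
  have neg: "x div int e < 0 \<longleftrightarrow> x < 0" for x
    using assms(1) by (simp add: pos_imp_zdiv_neg_iff)
  have nil_rot: "x \<in> beta_set [] \<longleftrightarrow> rotate_runners e t x \<in> beta_set []" for x
    using neg[of x] neg[of "rotate_runners e t x"] assms(1) by (simp add: beta_set_Nil)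
  have "int (residue_count e i m) =
      (\<Sum>a=1..M*e. F (rotate_runners e t (bead m a))) - (\<Sum>a=1..M*e. F (rotate_runners e t (bead [] a)))"
    unfolding residue_count_eq_sum[OF i len(2)] sum_subtractf[symmetric] F_def k_def
    by (simp only: rotate_runners_crossings[OF i t])
  also have "\<dots> = (\<Sum>a=1..M*e. F (bead l a)) - (\<Sum>a=1..M*e. F (bead [] a))"
    using sum_over_rotated_beads[OF assms(1-3) rot len(1,2)]
      sum_over_rotated_beads[OF assms(1) nil nil nil_rot len(3,3)] by simp
  also have "\<dots> = int (residue_count e k l) + int (residue_count e 0 l) - int (residue_count e t l)"
  proof -
    have "0 \<in> {0..<int e}" using assms(1) by simp
    note c = residue_count_eq_sum[OF k len(1)] residue_count_eq_sum[OF this len(1)]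
      residue_count_eq_sum[OF t len(1)]
    show ?thesis
      unfolding c F_def by (simp add: sum_subtractf sum.distrib del: diff_0_right)
  qed
  finally show ?thesis by (simp add: k_def)
qed

section \<open>The shifted partition\<close>

lemma rotated_partition_exists:
  assumes "0 < e" "is_partition l"
  shows "\<exists>m. is_partition m \<and> (\<forall>x. x \<in> beta_set m \<longleftrightarrow> rotate_runners e t x \<in> beta_set l)"
proof -
  define B where "B = {x. rotate_runners e t x \<in> beta_set l}"
  define n where "n = length l * e"
  have n: "length l \<le> n" using assms(1) by (simp add: n_def)
  have above: "- int n \<le> rotate_runners e t x \<longleftrightarrow> - int n \<le> x" for t x
    unfolding n_def by (rule rotate_runners_ge_iff[OF assms(1)])
  have rotate: "bij_betw (rotate_runners e t) {x \<in> B. - int n \<le> x} {x \<in> beta_set l. - int n \<le> x}"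
    using assms(1) above unfolding B_def
    by (intro bij_betw_byWitness[where f' = "rotate_runners e (- t)"])
      (auto simp: rotate_runners_inverse)
  have number: "bij_betw (bead l) {1..n} {x \<in> beta_set l. - int n \<le> x}"
    unfolding bij_betw_def using beta_set_truncate[OF n] inj_on_bead[OF assms(2)] by blast
  have "card {x \<in> B. - int n \<le> x} = n"
    using bij_betw_same_card[OF rotate] bij_betw_same_card[OF number] by simp
  moreover have "finite {x \<in> B. - int n \<le> x}"
    using bij_betw_finite[OF rotate] bij_betw_finite[OF number] by simp
  moreover have "{..< - int n} \<subseteq> B"
  proof
    fix x assume "x \<in> {..< - int n}"
    then have "rotate_runners e t x < - int n" using above[of t x] by auto
    then show "x \<in> B" using below_in_beta_set[OF n] by (simp add: B_def)
  qed
  ultimately show ?thesis using beta_set_exists[of B n] by (auto simp: B_def)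
qed

lemma rotate_runners_mod_shift: "rotate_runners e (t mod int e) = rotate_runners e t"
  by (simp add: rotate_runners_def fun_eq_iff mod_simps)

lemma shift_partition_rotates:
  assumes "0 < e" "is_partition l"
  shows "is_partition (shift_partition e e' l)"
    and "x \<in> beta_set (shift_partition e e' l) \<longleftrightarrow> rotate_runners e (int e') x \<in> beta_set l"
proof -
  let ?P = "\<lambda>m. is_partition m \<and>
    (\<forall>x. x \<in> beta_set m \<longleftrightarrow> rotate_runners e (int e') x \<in> beta_set l)"
  obtain m where m: "?P m" using rotated_partition_exists[OF assms] by blast
  have "\<exists>!m. ?P m"
  proof (rule ex1I[of ?P, OF m])
    fix k assume k: "?P k"
    have "beta_set k = beta_set m" by (rule set_eqI) (simp only: k m)
    then show "k = m" using beta_set_inject k m by simp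
  qed
  then have "?P (THE m. ?P m)" by (rule theI')
  then have "?P (shift_partition e e' l)"
    unfolding shift_partition_def runner_eq_iff[OF assms(1)] .
  then show "is_partition (shift_partition e e' l)"
    and "x \<in> beta_set (shift_partition e e' l) \<longleftrightarrow> rotate_runners e (int e') x \<in> beta_set l"
    by blast+
qed

section \<open>Comparison in the root lattice\<close>

lemma lookup_alpha:
  "Poly_Mapping.lookup (alpha e l) k = (if k \<in> {0..<int e} then int (residue_count e k l) else 0)"
  by (simp add: alpha_def lookup_sum if_distrib cong: if_cong)

lemma lookup_shift_Q_alpha:
  assumes "0 < e"
  shows "Poly_Mapping.lookup (shift_Q e e' (alpha e l)) k =
    (if k \<in> {0..<int e} then int (residue_count e ((k + int e') mod int e) l) else 0)"
proof -
  have "shift_Q e e' (alpha e l) = (\<Sum>i\<in>{0..<int e}.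
      frag_cmul (int (residue_count e i l)) (frag_of ((i - int e') mod int e)))"
    unfolding shift_Q_def alpha_def by (simp add: frag_extend_sum o_def frag_extend_cmul)
  also have "\<dots> = (\<Sum>k\<in>{0..<int e}.
      frag_cmul (int (residue_count e ((k + int e') mod int e) l)) (frag_of k))"
    using assms by (intro sum.reindex_bij_witness[of _ "\<lambda>k. (k + int e') mod int e"
          "\<lambda>i. (i - int e') mod int e"]) (auto simp: mod_simps)
  finally show ?thesis
    by (simp add: lookup_sum if_distrib cong: if_cong)
qed

theorem theorem3:
  fixes e p e' :: nat and l :: "nat list"
  assumes "2 \<le> e" and "0 < p" and "p dvd e" and "e' = e div p"
    and "is_partition l"
  shows "(alpha e (shift_partition e e' l) = shift_Q e e' (alpha e l)
            \<longleftrightarrow> sum_list (shift_partition e e' l) = sum_list l) \<and>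
         (sum_list (shift_partition e e' l) = sum_list l
            \<longleftrightarrow> residue_count e 0 l = residue_count e (int e' mod int e) l)"
proof -
  let ?m = "shift_partition e e' l"
  define t where "t = int e' mod int e"
  define d where "d = int (residue_count e 0 l) - int (residue_count e t l)"
  have e: "0 < e" using assms(1) by simp
  have count: "int (residue_count e i ?m) = int (residue_count e ((i + int e') mod int e) l) + d"
    if "i \<in> {0..<int e}" for i
  proof -
    have "(i + t) mod int e = (i + int e') mod int e" by (simp add: t_def mod_simps)
    moreover have "t \<in> {0..<int e}" using e by (simp add: t_def)
    ultimately show ?thesis
      using residue_count_rotated[of e l ?m t i] that e assms(5)
        shift_partition_rotates[OF e assms(5)]
      by (simp add: d_def t_def rotate_runners_mod_shift)
  qed
  have *: "alpha e ?m = shift_Q e e' (alpha e l) \<longleftrightarrow> (\<forall>i\<in>{0..<int e}.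
      int (residue_count e i ?m) = int (residue_count e ((i + int e') mod int e) l))"
    unfolding poly_mapping_eq_iff fun_eq_iff lookup_alpha lookup_shift_Q_alpha[OF e] by auto
  have alpha_iff: "alpha e ?m = shift_Q e e' (alpha e l) \<longleftrightarrow> d = 0"
  proof -
    have "0 \<in> {0..<int e}" using e by simp
    then show ?thesis
      unfolding * by (metis (no_types, lifting) count add_cancel_left_right add_0_right)
  qed
  have "int (sum_list ?m) = (\<Sum>i\<in>{0..<int e}. int (residue_count e ((i + int e') mod int e) l) + d)"
    unfolding sum_list_eq_sum_residue_count[OF e] using count by (intro sum.cong) auto
  also have "\<dots> = (\<Sum>i\<in>{0..<int e}. int (residue_count e i l)) + int e * d"
    unfolding sum.distrib using e
    by (intro arg_cong2[where f = "(+)"] sum.reindex_bij_witness[of _ "\<lambda>i. (i - int e') mod int e"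
          "\<lambda>i. (i + int e') mod int e"]) (auto simp: mod_simps)
  also have "\<dots> = int (sum_list l) + int e * d"
    by (simp only: sum_list_eq_sum_residue_count[OF e])
  finally have "sum_list ?m = sum_list l \<longleftrightarrow> d = 0" using e by auto
  then show ?thesis using alpha_iff by (auto simp: d_def t_def)
qed

end
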